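(* Let $f:\operatorname{dom} f\subseteq\mathbb{R}^n\to\mathbb{R}$ be $\mathcal{C}^4$ on $B_n(x^0;\overline{\Delta})$, where $x^0\in\operatorname{dom} f$ is the point of interest and $\overline{\Delta}>0$. Denote by $L_{\nabla^2 f}\ge0$ and $L_{\nabla^3 f}\ge0$ the Lipschitz constants of $\nabla^2 f$ and $\nabla^3 f$ on $\overline{B}_n(x^0;\overline{\Delta})$, respectively. Let $i\in\{1,\dots,n\}$, let $S=he^i\in\mathbb{R}^n$ where $h\ne0$, and let $\overline{T}\in\mathbb{R}^{n\times k}$. Assume that $B_n(x^0+he^i;\Delta_{\overline{T}})\subset B_n(x^0;\overline{\Delta})$. Then (i) $$\left\|\operatorname{P}_{S,\overline{T}}\nabla_s^2 f(x^0;S,\overline{T})-\operatorname{P}_{S,\overline{T}}\nabla^2 f(x^0)\right\|=\left\|\nabla_s^2 f(x^0;S,\overline{T})-\operatorname{P}_{S,\overline{T}}\operatorname{Diag}(e^i)\nabla^2 f(x^0)\right\|\le 4\sqrt{k}\,L_{\nabla^2 f}\left(\frac{\Delta_u}{\Delta_l}\right)\|\widehat{\overline{T}}^\dagger\|\,\Delta_u,$$ and (ii) $$\left\|\operatorname{P}_{S,\overline{T}}\nabla_c^2 f(x^0;S,\overline{T})-\operatorname{P}_{S,\overline{T}}\nabla^2 f(x^0)\right\|=\left\|\nabla_c^2 f(x^0;S,\overline{T})-\operatorname{P}_{S,\overline{T}}\operatorname{Diag}(e^i)\nabla^2 f(x^0)\right\|\le 2\sqrt{k}\,L_{\nabla^3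 f}\left(\frac{\Delta_u}{\Delta_l}\right)\|\widehat{\overline{T}}^\dagger\|\,\Delta_u^2.$$
   Context: $\|\cdot\|$ is the Euclidean norm on vectors and the induced (spectral) norm on matrices. $B_n(x;\Delta)$ and $\overline{B}_n(x;\Delta)$ are the open and closed balls in $\mathbb{R}^n$ centered at $x$ of radius $\Delta$. $e^i$ is the $i$-th standard basis vector of $\mathbb{R}^n$; $\operatorname{Diag}(v)$ is the diagonal matrix with diagonal $v$. $A^\dagger$ is the Moore-Penrose pseudoinverse of a real matrix $A$ (vectors in $\mathbb{R}^n$ are $n\times1$ matrices). $\oplus$ is the Minkowski sum; a matrix is identified with the set of its columns. Generalized simplex gradient: for a matrix $T=\begin{bmatrix}t^1&\cdots&t^k\end{bmatrix}\in\mathbb{R}^{n\times k}$ and a point $x$ with $x\in\operatorname{dom} f$ and $x\oplus T\subset\operatorname{dom} f$, $\nabla_s f(x;T)=(T^\top)^\dagger\,\delta_s f(x;T)\in\mathbb{R}^n$, where $\delta_s f(x;T)=\big(f(x+t^1)-f(x),\dots,f(x+t^k)-f(x)\big)^\top\in\mathbb{R}^k$. Generalized simplex Hessian (with the same matrix $\overline{T}$ used for every column of $S$): for $S=\begin{bmatrix}s^1&\cdots&s^m\end{bmatrix}\in\mathbb{R}^{n\times m}$ and $\overline{T}\in\mathbb{R}^{n\times k}$ such that $x^0\oplus\overline{T}$, $x^0\oplus S$, $x^0+s^j\oplus\overline{T}$ are contained in $\operatorname{dom} f$ for all $j$, $\nabla_s^2 f(x^0;S,\overline{T})=(S^\top)^\dagger\,\delta_s^2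 f(x^0;S,\overline{T})\in\mathbb{R}^{n\times n}$, where $\delta_s^2 f(x^0;S,\overline{T})\in\mathbb{R}^{m\times n}$ is the matrix whose $j$-th row is $\big(\nabla_s f(x^0+s^j;\overline{T})-\nabla_s f(x^0;\overline{T})\big)^\top$. (Here $m=1$.) Generalized centered simplex Hessian: $\nabla_c^2 f(x^0;S,\overline{T})=\tfrac12\big(\nabla_s^2 f(x^0;S,\overline{T})+\nabla_s^2 f(x^0;-S,-\overline{T})\big)$; it is defined when $x^0\oplus S\oplus\overline{T}$, $x^0\oplus(-S)\oplus(-\overline{T})$, $x^0\oplus(\pm S)$ and $x^0\oplus(\pm\overline{T})$ are contained in $\operatorname{dom} f$. Projection operator: for $M\in\mathbb{R}^{n\times n}$, $\operatorname{P}_{S,\overline{T}}M=(S^\top)^\dagger S^\top M\,\overline{T}\,\overline{T}^\dagger$; $\operatorname{P}_{S,\overline{T}}\operatorname{Diag}(e^i)\nabla^2 f(x^0)$ means $\operatorname{P}_{S,\overline{T}}$ applied to the product $\operatorname{Diag}(e^i)\nabla^2 f(x^0)$. Radii and normalized matrices: $\Delta_S=\|he^i\|=|h|$; $\Delta_{\overline{T}}$ is the maximum norm of a column of $\overline{T}$; $\widehat{\overline{T}}=\overline{T}/\Delta_{\overline{T}}$; $\Delta_u=\max\{\Delta_S,\Delta_{\overline{T}}\}$; $\Delta_l=\min\{\Delta_S,\Delta_{\overline{T}}\}$. Standing assumptions: all points required by these definitions lie in $\operatorname{dom} f$; $S$ and $\overline{T}$ are non-empty with non-null rank. *)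

theory Defs
  imports "HOL-Analysis.Analysis"
begin

section \<open>Derivatives\<close>

text \<open>
  Derivatives are taken relative to a set \<open>X\<close>, so that they also make sense on the boundary of a
  closed ball. On the interior of \<open>X\<close> they are the usual derivatives (see
  \<open>hessian_interior\<close> below). The result is meaningful only where the function is differentiable
  within \<open>X\<close>. Iterated derivatives live in nested spaces of bounded linear maps, whose norm is the
  operator norm of the corresponding multilinear form.
\<close>

definition fderiv ::
    "'a set \<Rightarrow> ('a::real_normed_vector \<Rightarrow> 'b::real_normed_vector) \<Rightarrow> 'a \<Rightarrow> 'a \<Rightarrow>\<^sub>L 'b" where
  "fderiv X f x = Blinfun (frechet_derivative f (at x within X))"

definition fderiv2 ::
    "'a set \<Rightarrow> ('a::real_normed_vector \<Rightarrow> 'b::real_normed_vector) \<Rightarrow> 'a \<Rightarrow> 'a \<Rightarrow>\<^sub>L 'a \<Rightarrow>\<^sub>L 'b" where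
  "fderiv2 X f = fderiv X (fderiv X f)"

definition fderiv3 ::
    "'a set \<Rightarrow> ('a::real_normed_vector \<Rightarrow> 'b::real_normed_vector) \<Rightarrow> 'a
      \<Rightarrow> 'a \<Rightarrow>\<^sub>L 'a \<Rightarrow>\<^sub>L 'a \<Rightarrow>\<^sub>L 'b" where
  "fderiv3 X f = fderiv X (fderiv2 X f)"

definition fderiv4 ::
    "'a set \<Rightarrow> ('a::real_normed_vector \<Rightarrow> 'b::real_normed_vector) \<Rightarrow> 'a
      \<Rightarrow> 'a \<Rightarrow>\<^sub>L 'a \<Rightarrow>\<^sub>L 'a \<Rightarrow>\<^sub>L 'a \<Rightarrow>\<^sub>L 'b" where
  "fderiv4 X f = fderiv X (fderiv3 X f)"

definition thrice_differentiable_on ::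
    "('a::real_normed_vector \<Rightarrow> 'b::real_normed_vector) \<Rightarrow> 'a set \<Rightarrow> bool" where
  "thrice_differentiable_on f X \<longleftrightarrow>
     f differentiable_on X \<and> fderiv X f differentiable_on X \<and> fderiv2 X f differentiable_on X"

definition C4_on :: "('a::real_normed_vector \<Rightarrow> 'b::real_normed_vector) \<Rightarrow> 'a set \<Rightarrow> bool" where
  "C4_on f X \<longleftrightarrow>
     thrice_differentiable_on f X \<and> fderiv3 X f differentiable_on X \<and> continuous_on X (fderiv4 X f)"

definition hessian :: "(real^'n) set \<Rightarrow> (real^'n \<Rightarrow> real) \<Rightarrow> real^'n \<Rightarrow> real^'n^'n" where
  "hessian X f x = (\<chi> i j. blinfun_apply (blinfun_apply (fderiv2 X f x) (axis i 1)) (axis j 1))"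

lemma fderiv_interior:
  assumes "x \<in> interior X"
  shows "fderiv X f x = fderiv UNIV f x"
  by (simp add: fderiv_def at_within_interior[OF assms])

lemma fderiv2_interior:
  assumes "x \<in> interior X"
  shows "fderiv2 X f x = fderiv2 UNIV f x"
proof -
  have eq: "fderiv X f y = fderiv UNIV f y" if "y \<in> interior X" for y
    using that by (rule fderiv_interior)
  have "(fderiv X f has_derivative g) (at x) \<longleftrightarrow> (fderiv UNIV f has_derivative g) (at x)" for g
    using has_derivative_transform_within_open[OF _ open_interior assms, of "fderiv X f" g UNIV "fderiv UNIV f"]
      has_derivative_transform_within_open[OF _ open_interior assms, of "fderiv UNIV f" g UNIV "fderiv X f"]
      eq by auto
  then have "frechet_derivative (fderiv X f) (at x) = frechet_derivative (fderiv UNIV f) (at x)"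
    by (simp add: frechet_derivative_def)
  then show ?thesis
    by (simp add: fderiv2_def fderiv_def[of _ "fderiv _ f"] at_within_interior[OF assms])
qed

lemma hessian_interior:
  assumes "x \<in> interior X"
  shows "hessian X f x = hessian UNIV f x"
  by (simp add: hessian_def fderiv2_interior[OF assms])

section \<open>Matrices\<close>

definition spec_norm :: "real^'n^'m \<Rightarrow> real" where
  "spec_norm A = onorm ((*v) A)"

definition is_pinv :: "real^'n^'m \<Rightarrow> real^'m^'n \<Rightarrow> bool" where
  "is_pinv A X \<longleftrightarrow>
     A ** X ** A = A \<and> X ** A ** X = X \<and>
     transpose (A ** X) = A ** X \<and> transpose (X ** A) = X ** A"

text \<open>The Moore-Penrose pseudoinverse, the unique solution of the four Penrose equations.\<close>

definition pinv :: "real^'n^'m \<Rightarrow> real^'m^'n" where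
  "pinv A = (THE X. is_pinv A X)"

definition Diag :: "real^'n \<Rightarrow> real^'n^'n" where
  "Diag v = (\<chi> i j. if i = j then v $ i else 0)"

definition radius :: "real^'k^'n \<Rightarrow> real" where
  "radius T = Max (range (\<lambda>j. norm (column j T)))"

definition normalized :: "real^'k^'n \<Rightarrow> real^'k^'n" where
  "normalized T = (1 / radius T) *\<^sub>R T"

definition radius_u :: "real^'m^'n \<Rightarrow> real^'k^'n \<Rightarrow> real" where
  "radius_u S T = max (radius S) (radius T)"

definition radius_l :: "real^'m^'n \<Rightarrow> real^'k^'n \<Rightarrow> real" where
  "radius_l S T = min (radius S) (radius T)"

section \<open>Generalized simplex derivatives\<close>

text \<open>
  The function \<open>f\<close> is total; its domain \<open>D\<close> appears only in the predicates saying that all sample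
  points belong to it.
\<close>

definition simplex_gradient :: "(real^'n \<Rightarrow> real) \<Rightarrow> real^'n \<Rightarrow> real^'k^'n \<Rightarrow> real^'n" where
  "simplex_gradient f x T = pinv (transpose T) *v (\<chi> j. f (x + column j T) - f x)"

definition simplex_hessian ::
    "(real^'n \<Rightarrow> real) \<Rightarrow> real^'n \<Rightarrow> real^'m^'n \<Rightarrow> real^'k^'n \<Rightarrow> real^'n^'n" where
  "simplex_hessian f x S T =
     pinv (transpose S) **
       (\<chi> j. simplex_gradient f (x + column j S) T - simplex_gradient f x T)"

definition simplex_hessian_defined ::
    "(real^'n) set \<Rightarrow> real^'n \<Rightarrow> real^'m^'n \<Rightarrow> real^'k^'n \<Rightarrow> bool" where
  "simplex_hessian_defined D x S T \<longleftrightarrow>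
     {x + t | t. t \<in> columns T} \<subseteq> D \<and> {x + s | s. s \<in> columns S} \<subseteq> D \<and>
     {x + s + t | s t. s \<in> columns S \<and> t \<in> columns T} \<subseteq> D"

definition centered_simplex_hessian ::
    "(real^'n \<Rightarrow> real) \<Rightarrow> real^'n \<Rightarrow> real^'m^'n \<Rightarrow> real^'k^'n \<Rightarrow> real^'n^'n" where
  "centered_simplex_hessian f x S T =
     (1/2) *\<^sub>R (simplex_hessian f x S T + simplex_hessian f x (- S) (- T))"

definition centered_simplex_hessian_defined ::
    "(real^'n) set \<Rightarrow> real^'n \<Rightarrow> real^'m^'n \<Rightarrow> real^'k^'n \<Rightarrow> bool" where
  "centered_simplex_hessian_defined D x S T \<longleftrightarrow>
     simplex_hessian_defined D x S T \<and> simplex_hessian_defined D x (- S) (- T)"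

definition proj_op :: "real^'m^'n \<Rightarrow> real^'k^'n \<Rightarrow> real^'n^'n \<Rightarrow> real^'n^'n" where
  "proj_op S T M = pinv (transpose S) ** transpose S ** M ** T ** pinv T"

end

theory Submission
  imports Defs
begin

text \<open>
  Since \<open>S\<close> has the single column \<open>h e\<^sup>i\<close>, each difference in the statement has only its \<open>i\<close>-th
  row nonzero and has the form \<open>e\<^sup>i v\<^sup>T T\<^sup>\<dagger>\<close>. So its spectral norm is at most \<open>norm v\<close> times that of \<open>T\<^sup>\<dagger>\<close>, and
  each entry of \<open>v\<close> compares a second difference of \<open>f\<close> along \<open>h e\<^sup>i\<close> and a column \<open>t\<close> of \<open>T\<close>
  with the second derivative at \<open>x0\<close>. The mean value theorem, applied once in each direction,
  turns the second difference into a second derivative at one point of the open parallelogram, at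
  distance at most \<open>norm (h e\<^sup>i) + norm t\<close> from \<open>x0\<close>. The inclusion of the balls keeps this
  parallelogram, except possibly for a vertex, inside the open ball. In the centered case the same
  argument is applied to \<open>f (x0 + y) + f (x0 - y)\<close>, which gives second derivatives at two points
  symmetric about \<open>x0\<close>, so that the first-order error cancels.
\<close>

section \<open>The Moore-Penrose pseudoinverse\<close>

text \<open>Split \<open>y = p + z\<close> with \<open>p\<close> in the range of \<open>A\<close>
  and \<open>z\<close> orthogonal to it. Then the transpose of \<open>A\<close> kills
  \<open>z\<close>, so any preimage of \<open>p\<close> solves the normal equations for
  \<open>y\<close>. The columns of \<open>Y\<close> are such solutions for the basis
  vectors.\<close>

lemma normal_equations_solvable:
  fixes A :: "real^'n^'m"
  obtains Y :: "real^'m^'n" where "transpose A ** A ** Y = transpose A"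
proof -
  have "\<exists>x. transpose A *v (A *v x) = transpose A *v y" for y
  proof -
    obtain p z where p: "p \<in> span (range ((*v) A))"
      and z: "\<And>w. w \<in> span (range ((*v) A)) \<Longrightarrow> orthogonal z w" and y: "y = p + z"
      using orthogonal_subspace_decomp_exists[of "range ((*v) A)" y] by metis
    have "span (range ((*v) A)) = range ((*v) A)"
      by (simp add: span_eq_iff linear_subspace_image)
    then obtain x where x: "p = A *v x"
      using p by blast
    have "(z v* A) \<bullet> w = 0" for w
      using z[of "A *v w"] by (simp add: dot_lmul_matrix orthogonal_def span_base)
    then have "z v* A = 0"
      by (metis inner_eq_zero_iff)
    then show ?thesis
      by (intro exI[of _ x]) (simp add: y x vector_matrix_left_distrib)
  qed
  then obtain g where g: "\<And>y. transpose A *v (A *v g y) = transpose A *v y"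
    by metis
  define Y :: "real^'m^'n" where "Y = (\<chi> a b. g (axis b 1) $ a)"
  have Y: "column b Y = g (axis b 1)" for b
    by (simp add: Y_def column_def vec_eq_iff)
  have col: "column b (M ** Y) = M *v column b Y" for b and M :: "real^'n^'n"
    by (simp add: vec_eq_iff column_def matrix_matrix_mult_def matrix_vector_mult_def)
  have "column b (transpose A ** A ** Y) = column b (transpose A)" for b
    by (simp only: col Y g matrix_vector_mul_assoc[symmetric] matrix_vector_mul_component
        matrix_vector_mult_basis)
  then have "transpose A ** A ** Y = transpose A"
    by (simp add: column_def vec_eq_iff)
  then show thesis ..
qed

text \<open>Transposing the normal equations gives \<open>transpose (A ** Y) ** A = A\<close>.
  Multiplied by \<open>Y\<close> on the right, this writes \<open>A ** Y\<close> as a product of the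
  form \<open>transpose B ** B\<close>, which is symmetric.\<close>

lemma inverse_13_exists:
  fixes A :: "real^'n^'m"
  obtains Y where "A ** Y ** A = A" "transpose (A ** Y) = A ** Y"
proof -
  obtain Y where Y: "transpose A ** A ** Y = transpose A"
    by (rule normal_equations_solvable)
  have "transpose (transpose A ** A ** Y) = A"
    by (simp add: Y)
  then have YT: "transpose (A ** Y) ** A = A"
    by (simp add: matrix_transpose_mul matrix_mul_assoc)
  have sym: "transpose (A ** Y) = A ** Y"
  proof -
    have "transpose (A ** Y) ** (A ** Y) = A ** Y"
      by (metis YT matrix_mul_assoc)
    then show ?thesis
      by (metis matrix_transpose_mul transpose_transpose)
  qed
  with YT that show thesis by simp
qed

text \<open>\<open>Y\<close> satisfies the first and third Penrose equations, and \<open>Z\<close>,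
  obtained by transposing such an inverse of \<open>transpose A\<close>, the first and fourth. The
  product \<open>Z ** A ** Y\<close> satisfies all four, since it acts like \<open>Y\<close> to the
  right of \<open>A\<close> and like \<open>Z\<close> to the left of \<open>A\<close>.\<close>

lemma is_pinv_exists:
  fixes A :: "real^'n^'m"
  shows "\<exists>X. is_pinv A X"
proof -
  obtain Y where Y: "A ** Y ** A = A" "transpose (A ** Y) = A ** Y"
    by (rule inverse_13_exists)
  obtain W where W: "transpose A ** W ** transpose A = transpose A"
      "transpose (transpose A ** W) = transpose A ** W"
    by (rule inverse_13_exists)
  define Z where "Z = transpose W"
  have Z: "A ** Z ** A = A" "transpose (Z ** A) = Z ** A"
    using W unfolding Z_def
    by (metis matrix_mul_assoc matrix_transpose_mul transpose_transpose)+
  have 1: "A ** (Z ** A ** Y) = A ** Y"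
    by (metis Z(1) matrix_mul_assoc)
  have 2: "(Z ** A ** Y) ** A = Z ** A"
    by (metis Y(1) matrix_mul_assoc)
  have 3: "Z ** A ** (Z ** A ** Y) = Z ** A ** Y"
    by (metis 1 matrix_mul_assoc)
  show ?thesis
    unfolding is_pinv_def
    by (intro exI[of _ "Z ** A ** Y"]) (simp only: 1 2 3 Y Z simp_thms)
qed

text \<open>By symmetry of the products, transposing \<open>A ** X = A ** Y ** A ** X\<close> swaps
  its factors and yields \<open>A ** X = A ** Y\<close>; likewise \<open>X ** A = Y ** A\<close>.
  Then \<open>X = X A X = X A Y = Y A Y = Y\<close>.\<close>

lemma is_pinv_unique:
  fixes A :: "real^'n^'m"
  assumes X: "is_pinv A X" and Y: "is_pinv A Y"
  shows "X = Y"
proof -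
  have "A ** X = A ** Y"
  proof -
    have "A ** X = transpose (A ** Y ** A ** X)"
      using X Y by (simp add: is_pinv_def)
    also have "\<dots> = transpose (A ** X) ** transpose (A ** Y)"
      by (metis matrix_mul_assoc matrix_transpose_mul)
    also have "\<dots> = A ** X ** A ** Y"
      using X Y by (simp add: is_pinv_def matrix_mul_assoc)
    finally show ?thesis
      using X by (simp add: is_pinv_def)
  qed
  moreover have "X ** A = Y ** A"
  proof -
    have "X ** A = transpose (X ** A ** Y ** A)"
      using X Y unfolding is_pinv_def by (metis matrix_mul_assoc)
    also have "\<dots> = transpose (Y ** A) ** transpose (X ** A)"
      by (metis matrix_mul_assoc matrix_transpose_mul)
    also have "\<dots> = (Y ** A) ** (X ** A)"
      using X Y by (simp add: is_pinv_def)
    also have "\<dots> = Y ** (A ** X ** A)"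
      by (simp add: matrix_mul_assoc)
    finally show ?thesis
      using X by (simp add: is_pinv_def)
  qed
  ultimately show ?thesis
    using X Y unfolding is_pinv_def by (metis matrix_mul_assoc)
qed

section \<open>Computing with \<open>pinv\<close>: transposition, scaling, coordinate
  directions\<close>

lemma is_pinv_pinv: "is_pinv A (pinv A)"
  unfolding pinv_def using is_pinv_exists is_pinv_unique by (metis theI)

lemma pinv_eqI: "is_pinv A X \<Longrightarrow> pinv A = X"
  using is_pinv_pinv is_pinv_unique by blast

lemma pinv_transpose: "pinv (transpose A) = transpose (pinv A)"
proof (rule pinv_eqI)
  let ?X = "pinv A"
  have X: "A ** ?X ** A = A" "?X ** A ** ?X = ?X"
    "transpose (A ** ?X) = A ** ?X" "transpose (?X ** A) = ?X ** A"
    using is_pinv_pinv[of A] by (simp_all add: is_pinv_def)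
  have 1: "transpose A ** transpose ?X = ?X ** A" "transpose ?X ** transpose A = A ** ?X"
    using X(3,4) by (simp_all add: matrix_transpose_mul)
  have 2: "transpose A ** transpose ?X ** transpose A = transpose (A ** ?X ** A)"
    "transpose ?X ** transpose A ** transpose ?X = transpose (?X ** A ** ?X)"
    by (simp_all only: matrix_transpose_mul matrix_mul_assoc)
  show "is_pinv (transpose A) (transpose ?X)"
    unfolding is_pinv_def by (simp only: 2 X simp_thms) (simp only: 1 X simp_thms)
qed

lemma transpose_scaleR: "transpose (c *\<^sub>R A) = c *\<^sub>R transpose (A :: real^'n^'m)"
  by (simp add: transpose_def vec_eq_iff)

text \<open>Serves three purposes: \<open>c = h\<close> for the direction matrix,
  \<open>c = -1\<close> for the reflected matrices of the centered Hessian, and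
  \<open>c = 1 / radius T\<close> for the normalized matrix.\<close>

lemma pinv_scaleR:
  assumes "c \<noteq> 0"
  shows "pinv (c *\<^sub>R A) = (1 / c) *\<^sub>R pinv A"
proof (rule pinv_eqI)
  show "is_pinv (c *\<^sub>R A) ((1 / c) *\<^sub>R pinv A)"
    using is_pinv_pinv[of A] assms
    by (simp add: is_pinv_def matrix_scalar_ac scalar_matrix_assoc[symmetric] transpose_scaleR)
qed

lemma pinv_minus: "pinv (- A) = - pinv A"
  using pinv_scaleR[of "-1" A] by simp

lemma pinv_rowvector_axis:
  "pinv (rowvector (axis i 1) :: real^'n^1) = columnvector (axis i 1)"
proof (rule pinv_eqI)
  let ?R = "rowvector (axis i 1) :: real^'n^1" and ?C = "columnvector (axis i 1) :: real^1^'n"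
  have 1: "?R ** ?C = mat 1"
    by (simp add: vec_eq_iff matrix_matrix_mult_def rowvector_def columnvector_def mat_def axis_def
        mult_delta_left)
  have "?C ** ?R ** ?C = ?C"
    by (simp add: matrix_mul_assoc[symmetric] 1)
  with 1 show "is_pinv ?R ?C"
    by (simp add: is_pinv_def matrix_transpose_mul transpose_columnvector transpose_rowvector)
qed

lemma columnvector_scaleR: "columnvector (c *\<^sub>R v) = c *\<^sub>R columnvector (v :: real^'n)"
  by (simp add: columnvector_def vec_eq_iff)

lemma pinv_transpose_columnvector_axis:
  assumes "h \<noteq> 0"
  shows "pinv (transpose (columnvector (h *\<^sub>R axis i 1) :: real^1^'n))
           = columnvector ((1 / h) *\<^sub>R axis i 1)"
  using assms
  by (simp add: columnvector_scaleR transpose_scaleR pinv_scaleR transpose_columnvector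
      pinv_rowvector_axis)

section \<open>Matrices with a single nonzero row\<close>

text \<open>The outer product of the \<open>i\<close>-th basis vector with \<open>v\<close>. All
  matrices compared in the theorem have this shape, so their differences reduce to differences of
  vectors.\<close>

definition axis_row :: "'m \<Rightarrow> real^'n \<Rightarrow> real^'n^'m" where
  "axis_row i v = (\<chi> a b. if a = i then v $ b else 0)"

lemma row_axis_row [simp]: "row i (axis_row i v) = v"
  by (simp add: axis_row_def row_def vec_eq_iff)

lemma axis_row_diff: "axis_row i (v - w) = axis_row i v - axis_row i w"
  by (simp add: axis_row_def vec_eq_iff)

lemma axis_row_add: "axis_row i (v + w) = axis_row i v + axis_row i w"
  by (simp add: axis_row_def vec_eq_iff)

lemma axis_row_scaleR: "axis_row i (c *\<^sub>R v) = c *\<^sub>R axis_row i v"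
  by (simp add: axis_row_def vec_eq_iff)

lemma axis_row_mult: "axis_row i v ** M = axis_row i (v v* M)"
  by (simp add: axis_row_def vec_eq_iff matrix_matrix_mult_def vector_matrix_mult_def)

lemma Diag_axis_mult: "Diag (axis i 1) ** M = axis_row i (row i M)"
  by (simp add: axis_row_def Diag_def row_def axis_def vec_eq_iff matrix_matrix_mult_def
      mult_delta_left)

lemma axis_row_mult_vector: "axis_row i v *v x = (v \<bullet> x) *\<^sub>R axis i 1"
  by (simp add: axis_row_def vec_eq_iff matrix_vector_mult_def inner_vec_def axis_def)

section \<open>Spectral and Euclidean norm estimates\<close>

lemma norm_mult_le_spec_norm: "norm (A *v x) \<le> spec_norm A * norm x"
  unfolding spec_norm_def by (rule onorm) simp

lemma spec_norm_nonneg: "0 \<le> spec_norm A"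
  unfolding spec_norm_def by (rule onorm_pos_le) simp

text \<open>The image of \<open>x\<close> is a multiple of a unit vector with coefficient the inner
  product of \<open>v\<close> and \<open>P *v x\<close>, so Cauchy-Schwarz applies.\<close>

lemma spec_norm_axis_row: "spec_norm (axis_row i (v v* P)) \<le> norm v * spec_norm P"
  unfolding spec_norm_def
proof (rule onorm_bound)
  show "0 \<le> norm v * onorm ((*v) P)"
    by (simp add: onorm_pos_le)
  fix x
  have "norm (axis_row i (v v* P) *v x) = \<bar>v \<bullet> (P *v x)\<bar>"
    by (simp add: axis_row_mult_vector dot_lmul_matrix)
  also have "\<dots> \<le> norm v * norm (P *v x)"
    by (rule Cauchy_Schwarz_ineq2)
  also have "\<dots> \<le> norm v * (onorm ((*v) P) * norm x)"
    by (intro mult_left_mono norm_mult_le_spec_norm[unfolded spec_norm_def]) simp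
  finally show "norm (axis_row i (v v* P) *v x) \<le> norm v * onorm ((*v) P) * norm x"
    by (simp add: mult.assoc)
qed

lemma spec_norm_scaleR: "spec_norm (c *\<^sub>R A) = \<bar>c\<bar> * spec_norm A"
proof -
  have "(*v) (c *\<^sub>R A) = (\<lambda>x. c *\<^sub>R (A *v x))"
    by (simp add: fun_eq_iff scaleR_matrix_vector_assoc)
  then show ?thesis
    by (simp add: spec_norm_def onorm_scaleR)
qed

text \<open>Source of the factor sqrt(k) in both bounds.\<close>

lemma norm_vec_le_sqrt_card:
  fixes v :: "real^'k"
  assumes "\<And>j. \<bar>v $ j\<bar> \<le> c"
  shows "norm v \<le> sqrt (real CARD('k)) * c"
proof -
  have "0 \<le> c"
    using assms[of undefined] by linarith
  have "norm v \<le> L2_set (\<lambda>j::'k. c) UNIV"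
    unfolding norm_vec_def by (rule L2_set_mono) (use assms in auto)
  then show ?thesis
    using \<open>0 \<le> c\<close> by (simp add: L2_set_constant)
qed

section \<open>Simplex Hessians along a coordinate direction\<close>

lemma column_columnvector [simp]: "column j (columnvector v) = v"
  by (simp add: column_def columnvector_def vec_eq_iff)

lemma column_minus: "column j (- A) = - column j (A :: real^'n^'m)"
  by (simp add: column_def vec_eq_iff)

text \<open>The pseudoinverse of the row \<open>h e^i\<close> is the column \<open>e^i / h\<close>,
  which puts the result into row \<open>i\<close>. Both simplex gradients apply the same matrix, so
  their difference is that matrix applied to second differences of \<open>f\<close>.\<close>

lemma simplex_hessian_axis:
  fixes T :: "real^'k^'n"
  assumes "h \<noteq> 0"
  shows "simplex_hessian f x (columnvector (h *\<^sub>R axis i 1) :: real^1^'n) T =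
    axis_row i ((\<chi> j. (f (x + h *\<^sub>R axis i 1 + column j T) - f (x + h *\<^sub>R axis i 1)
      - f (x + column j T) + f x) / h) v* pinv T)"
proof -
  let ?g = "\<lambda>y. (\<chi> j. f (y + column j T) - f y)"
  let ?v = "(?g (x + h *\<^sub>R axis i 1) - ?g x) v* pinv T"
  have "simplex_hessian f x (columnvector (h *\<^sub>R axis i 1) :: real^1^'n) T =
      columnvector ((1 / h) *\<^sub>R axis i 1) ** (\<chi> j::1. ?v)"
    using assms
    by (simp add: simplex_hessian_def simplex_gradient_def pinv_transpose_columnvector_axis
        pinv_transpose[of T] vector_matrix_mult_diff_distrib)
  also have "\<dots> = axis_row i ((1 / h) *\<^sub>R ?v)"
    by (simp add: vec_eq_iff columnvector_def matrix_matrix_mult_def axis_row_def axis_def)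
  also have "(1 / h) *\<^sub>R ?v = ((1 / h) *\<^sub>R (?g (x + h *\<^sub>R axis i 1) - ?g x)) v* pinv T"
    by (simp add: scaleR_vector_matrix_assoc)
  also have "(1 / h) *\<^sub>R (?g (x + h *\<^sub>R axis i 1) - ?g x) =
      (\<chi> j. (f (x + h *\<^sub>R axis i 1 + column j T) - f (x + h *\<^sub>R axis i 1)
        - f (x + column j T) + f x) / h)"
    by (simp add: vec_eq_iff)
  finally show ?thesis .
qed

lemma centered_simplex_hessian_axis:
  fixes T :: "real^'k^'n"
  assumes "h \<noteq> 0"
  shows "centered_simplex_hessian f x (columnvector (h *\<^sub>R axis i 1) :: real^1^'n) T =
    axis_row i ((\<chi> j.
      ((f (x + h *\<^sub>R axis i 1 + column j T) - f (x + h *\<^sub>R axis i 1) - f (x + column j T) + f x)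
      + (f (x - h *\<^sub>R axis i 1 - column j T) - f (x - h *\<^sub>R axis i 1) - f (x - column j T) + f x))
      / (2 * h)) v* pinv T)"
proof -
  let ?p = "\<chi> j. (f (x + h *\<^sub>R axis i 1 + column j T) - f (x + h *\<^sub>R axis i 1)
      - f (x + column j T) + f x) / h"
  let ?q = "\<chi> j. (f (x - h *\<^sub>R axis i 1 - column j T) - f (x - h *\<^sub>R axis i 1)
      - f (x - column j T) + f x) / h"
  have half: "(1/2) * (a / h + b / h) = (a + b) / (2 * h)" for a b
    by (simp add: add_divide_distrib[symmetric])
  have neg: "- columnvector (h *\<^sub>R axis i 1) = (columnvector ((- h) *\<^sub>R axis i 1) :: real^1^'n)"
    by (simp add: columnvector_def vec_eq_iff)
  have mneg: "v v* (- P) = (- v) v* P" for v and P :: "real^'n^'k"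
    by (simp add: vector_matrix_mult_def vec_eq_iff)
  \<comment> \<open>Reflection produces two minus signs, one from \<open>pinv (- T)\<close> and one
    from dividing by \<open>- h\<close>. They cancel, so both halves of the centered Hessian add
    up.\<close>
  have "simplex_hessian f x (- columnvector (h *\<^sub>R axis i 1) :: real^1^'n) (- T) =
      axis_row i ((- (\<chi> j. (f (x - h *\<^sub>R axis i 1 - column j T) - f (x - h *\<^sub>R axis i 1)
      - f (x - column j T) + f x) / (- h))) v* pinv T)"
    unfolding neg using assms
    by (subst simplex_hessian_axis) (simp_all add: pinv_minus column_minus mneg)
  also have "- (\<chi> j. (f (x - h *\<^sub>R axis i 1 - column j T) - f (x - h *\<^sub>R axis i 1)
      - f (x - column j T) + f x) / (- h)) = ?q"
    by (simp add: vec_eq_iff)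
  finally have "centered_simplex_hessian f x (columnvector (h *\<^sub>R axis i 1) :: real^1^'n) T =
      (1/2) *\<^sub>R (axis_row i (?p v* pinv T) + axis_row i (?q v* pinv T))"
    using assms by (simp add: centered_simplex_hessian_def simplex_hessian_axis)
  also have "\<dots> = axis_row i (((1/2) *\<^sub>R (?p + ?q)) v* pinv T)"
    by (simp only: axis_row_add[symmetric] axis_row_scaleR[symmetric] scaleR_vector_matrix_assoc
        vector_matrix_left_distrib[symmetric])
  also have "(1/2) *\<^sub>R (?p + ?q) = (\<chi> j.
      ((f (x + h *\<^sub>R axis i 1 + column j T) - f (x + h *\<^sub>R axis i 1) - f (x + column j T) + f x)
      + (f (x - h *\<^sub>R axis i 1 - column j T) - f (x - h *\<^sub>R axis i 1) - f (x - column j T) + f x))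
      / (2 * h))"
    by (simp only: vec_eq_iff vector_add_component vector_scaleR_component vec_lambda_beta
        real_scaleR_def half simp_thms)
  finally show ?thesis .
qed

lemma proj_op_axis:
  fixes T :: "real^'k^'n"
  assumes "h \<noteq> 0"
  shows "proj_op (columnvector (h *\<^sub>R axis i 1) :: real^1^'n) T M =
    axis_row i ((row i M v* T) v* pinv T)"
proof -
  have "columnvector ((1 / h) *\<^sub>R axis i 1) ** transpose (columnvector (h *\<^sub>R axis i 1) :: real^1^'n)
      = Diag (axis i 1)"
    using assms
    by (simp add: vec_eq_iff columnvector_def transpose_def matrix_matrix_mult_def Diag_def axis_def)
  then show ?thesis
    using assms
    by (simp add: proj_op_def pinv_transpose_columnvector_axis Diag_axis_mult axis_row_mult)
qed

lemma proj_op_axis_Diag: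
  fixes T :: "real^'k^'n"
  assumes "h \<noteq> 0"
  shows "proj_op (columnvector (h *\<^sub>R axis i 1) :: real^1^'n) T (Diag (axis i 1) ** M) =
    proj_op (columnvector (h *\<^sub>R axis i 1) :: real^1^'n) T M"
  using assms by (simp add: proj_op_axis Diag_axis_mult)

text \<open>The projection fixes both simplex Hessians. Together with
  \<open>proj_op_axis_Diag\<close> this gives the equalities of norms in the theorem.\<close>

lemma proj_op_axis_row:
  fixes T :: "real^'k^'n"
  assumes "h \<noteq> 0"
  shows "proj_op (columnvector (h *\<^sub>R axis i 1) :: real^1^'n) T (axis_row i (v v* pinv T)) =
    axis_row i (v v* pinv T)"
proof -
  have "pinv T ** T ** pinv T = pinv T"
    using is_pinv_pinv[of T] by (simp add: is_pinv_def)
  then show ?thesis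
    by (simp only: proj_op_axis[OF assms] row_axis_row vector_matrix_mul_assoc)
qed

section \<open>Radii and the normalized matrix\<close>

lemma norm_column_le_radius: "norm (column j T) \<le> radius T"
  by (simp add: radius_def)

lemma radius_columnvector: "radius (columnvector v :: real^1^'n) = norm v"
  by (simp add: radius_def)

lemma radius_pos:
  assumes "rank T \<noteq> 0"
  shows "0 < radius T"
proof -
  obtain j where "column j T \<noteq> 0"
    using assms by (auto simp: rank_eq_0 vec_eq_iff column_def)
  then show ?thesis
    using norm_column_le_radius[of j T] less_le_trans zero_less_norm_iff by blast
qed

lemma spec_norm_pinv_normalized:
  assumes "0 < radius T"
  shows "spec_norm (pinv (normalized T)) = radius T * spec_norm (pinv T)"
  using assms by (simp add: normalized_def pinv_scaleR spec_norm_scaleR)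

section \<open>Mean value theorems for second differences\<close>

text \<open>The point \<open>s + t\<close> may lie on the sphere of radius \<open>\<Delta>\<close>,
  hence continuity on the closed ball but derivatives only inside. The separate bound
  \<open>\<rho> > 0\<close> keeps \<open>s\<close> strictly inside even when
  \<open>t = 0\<close>.\<close>

lemma second_difference_eq:
  fixes g :: "'a::real_normed_vector \<Rightarrow> real"
  assumes cont: "continuous_on (cball 0 \<Delta>) g"
    and g': "\<And>y. norm y < \<Delta> \<Longrightarrow> (g has_derivative g' y) (at y)"
    and g'': "\<And>y v. norm y < \<Delta> \<Longrightarrow> ((\<lambda>z. g' z v) has_derivative (\<lambda>u. g'' y u v)) (at y)"
    and s: "norm s + \<rho> \<le> \<Delta>" and t: "norm t \<le> \<rho>" and \<rho>: "0 < \<rho>"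
  obtains u where "norm u \<le> norm s + norm t" "norm u < \<Delta>"
    "g (s + t) - g s - g t + g 0 = g'' u s t"
proof -
  have small: "norm (a *\<^sub>R s + b *\<^sub>R t) < \<Delta>" if "0 \<le> a" "a \<le> 1" "0 \<le> b" "b < 1" for a b
  proof -
    have "norm (a *\<^sub>R s + b *\<^sub>R t) \<le> a * norm s + b * norm t"
      using norm_triangle_ineq[of "a *\<^sub>R s" "b *\<^sub>R t"] that by simp
    also have "\<dots> \<le> norm s + b * \<rho>"
      using that t by (intro add_mono mult_left_le_one_le mult_left_mono) auto
    also have "\<dots> < norm s + \<rho>"
      using that \<rho> by simp
    finally show ?thesis using s by simp
  qed
  have small': "norm (a *\<^sub>R s + b *\<^sub>R t) \<le> norm s + norm t" if "0 \<le> a" "a \<le> 1" "0 \<le> b" "b \<le> 1" for a b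
  proof -
    have "norm (a *\<^sub>R s + b *\<^sub>R t) \<le> a * norm s + b * norm t"
      using norm_triangle_ineq[of "a *\<^sub>R s" "b *\<^sub>R t"] that by simp
    also have "\<dots> \<le> norm s + norm t"
      using that by (intro add_mono mult_left_le_one_le) auto
    finally show ?thesis .
  qed
  \<comment> \<open>The direction \<open>t\<close> comes first: the only possible boundary points
    then occur at \<open>b = 1\<close>, an endpoint where the mean value theorem asks for continuity
    alone.\<close>
  define \<phi> where "\<phi> = (\<lambda>b::real. g (s + b *\<^sub>R t) - g (b *\<^sub>R t))"
  have d\<phi>: "(\<phi> has_real_derivative g' (s + b *\<^sub>R t) t - g' (b *\<^sub>R t) t) (at b)" if "0 \<le> b" "b < 1" for b
  proof -
    have "norm (s + b *\<^sub>R t) < \<Delta>" "norm (b *\<^sub>R t) < \<Delta>"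
      using small[of 1 b] small[of 0 b] that by auto
    note D = g'[OF this(1)] g'[OF this(2)]
    have "((\<lambda>b. g (s + b *\<^sub>R t)) has_derivative (\<lambda>c. g' (s + b *\<^sub>R t) (c *\<^sub>R t))) (at b)"
      "((\<lambda>b. g (b *\<^sub>R t)) has_derivative (\<lambda>c. g' (b *\<^sub>R t) (c *\<^sub>R t))) (at b)"
      by (rule has_derivative_compose[of "\<lambda>b. s + b *\<^sub>R t" _ _ _ g, OF _ D(1)]
          has_derivative_compose[of "\<lambda>b. b *\<^sub>R t" _ _ _ g, OF _ D(2)];
          auto intro!: derivative_eq_intros)+
    from has_derivative_diff[OF this] show ?thesis
      unfolding \<phi>_def
      by (rule has_derivative_imp_has_field_derivative)
        (simp add: linear_scale[OF has_derivative_linear] D[THEN has_derivative_linear, THEN linear_scale] algebra_simps)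
  qed
  have cont\<phi>: "continuous_on {0..1} \<phi>"
    unfolding \<phi>_def
  proof (intro continuous_on_diff continuous_on_compose2[OF cont] continuous_intros)
    show "(\<lambda>b. s + b *\<^sub>R t) ` {0..1} \<subseteq> cball 0 \<Delta>" "(\<lambda>b. b *\<^sub>R t) ` {0..1} \<subseteq> cball 0 \<Delta>"
      using small'[of 1] small'[of 0] s t by fastforce+
  qed
  have diff: "\<phi> differentiable (at b)" if "0 < b" "b < 1" for b
    using d\<phi>[of b] that by (auto simp: real_differentiable_def)
  obtain l b where b: "0 < b" "b < 1" "(\<phi> has_real_derivative l) (at b)" "\<phi> 1 - \<phi> 0 = (1 - 0) * l"
    using MVT[OF zero_less_one cont\<phi> diff] by blast
  then have eq1: "\<phi> 1 - \<phi> 0 = g' (s + b *\<^sub>R t) t - g' (b *\<^sub>R t) t"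
    using DERIV_unique[OF b(3) d\<phi>] by simp
  \<comment> \<open>As \<open>b < 1\<close>, the whole segment \<open>0 \<le> a \<le> 1\<close> lies
    in the open ball, so the second mean value step has derivatives at its endpoints too.\<close>
  define \<psi> where "\<psi> = (\<lambda>a::real. g' (a *\<^sub>R s + b *\<^sub>R t) t)"
  have d\<psi>: "(\<psi> has_real_derivative g'' (a *\<^sub>R s + b *\<^sub>R t) s t) (at a)" if "0 \<le> a" "a \<le> 1" for a
  proof -
    have "norm (a *\<^sub>R s + b *\<^sub>R t) < \<Delta>"
      using small[of a b] b that by auto
    note D = g''[OF this, of t]
    have "((\<lambda>a. g' (a *\<^sub>R s + b *\<^sub>R t) t) has_derivative (\<lambda>c. g'' (a *\<^sub>R s + b *\<^sub>R t) (c *\<^sub>R s) t)) (at a)"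
      by (rule has_derivative_compose[of "\<lambda>a. a *\<^sub>R s + b *\<^sub>R t" _ _ _ "\<lambda>z. g' z t", OF _ D])
        (auto intro!: derivative_eq_intros)
    then show ?thesis
      unfolding \<psi>_def
      by (rule has_derivative_imp_has_field_derivative)
        (simp add: D[THEN has_derivative_linear, THEN linear_scale] mult.commute)
  qed
  obtain a where a: "0 < a" "a < 1" "\<psi> 1 - \<psi> 0 = (1 - 0) * g'' (a *\<^sub>R s + b *\<^sub>R t) s t"
    using MVT2[OF zero_less_one d\<psi>] by blast
  show thesis
  proof
    show "norm (a *\<^sub>R s + b *\<^sub>R t) \<le> norm s + norm t" "norm (a *\<^sub>R s + b *\<^sub>R t) < \<Delta>"
      using a b by (auto intro!: small' small)
    show "g (s + t) - g s - g t + g 0 = g'' (a *\<^sub>R s + b *\<^sub>R t) s t"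
      using a eq1 by (simp add: \<phi>_def \<psi>_def)
  qed
qed

text \<open>The derivative of \<open>G (x + c u) + G (x - c u)\<close> in \<open>c\<close> compares
  \<open>G'\<close> at points \<open>2 c norm u\<close> apart. It is thus at most
  \<open>2 c K (norm u)^2\<close>, which accumulates to \<open>K (norm u)^2\<close> over the unit
  interval.\<close>

lemma symmetric_difference_bound:
  fixes G :: "'a::real_normed_vector \<Rightarrow> real"
  assumes G': "\<And>y. y \<in> ball x \<Delta> \<Longrightarrow> (G has_derivative G' y) (at y)"
    and lip: "\<And>y z v. y \<in> ball x \<Delta> \<Longrightarrow> z \<in> ball x \<Delta> \<Longrightarrow> \<bar>G' y v - G' z v\<bar> \<le> K * norm (y - z) * norm v"
    and u: "norm u < \<Delta>"
  shows "\<bar>G (x + u) + G (x - u) - 2 * G x\<bar> \<le> K * (norm u)\<^sup>2"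
proof -
  let ?\<theta> = "\<lambda>c::real. G (x + c *\<^sub>R u) + G (x - c *\<^sub>R u)"
  have ball: "x + c *\<^sub>R u \<in> ball x \<Delta>" "x - c *\<^sub>R u \<in> ball x \<Delta>" if "0 \<le> c" "c \<le> 1" for c
  proof -
    have "\<bar>c\<bar> * norm u \<le> norm u"
      using that by (simp add: mult_left_le_one_le)
    then show "x + c *\<^sub>R u \<in> ball x \<Delta>" "x - c *\<^sub>R u \<in> ball x \<Delta>"
      using u by (auto simp: dist_norm)
  qed
  have d\<theta>: "(?\<theta> has_real_derivative G' (x + c *\<^sub>R u) u - G' (x - c *\<^sub>R u) u) (at c)" if "0 \<le> c" "c \<le> 1" for c
  proof -
    note D = G'[OF ball(1)[OF that]] G'[OF ball(2)[OF that]]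
    have "((\<lambda>c. G (x + c *\<^sub>R u)) has_derivative (\<lambda>r. G' (x + c *\<^sub>R u) (r *\<^sub>R u))) (at c)"
      "((\<lambda>c. G (x - c *\<^sub>R u)) has_derivative (\<lambda>r. G' (x - c *\<^sub>R u) (- (r *\<^sub>R u)))) (at c)"
      by (rule has_derivative_compose[of "\<lambda>c. x + c *\<^sub>R u" _ _ _ G, OF _ D(1)]
          has_derivative_compose[of "\<lambda>c. x - c *\<^sub>R u" _ _ _ G, OF _ D(2)];
          auto intro!: derivative_eq_intros)+
    from has_derivative_add[OF this] show ?thesis
      by (rule has_derivative_imp_has_field_derivative)
        (simp add: D[THEN has_derivative_linear, THEN linear_scale]
          D[THEN has_derivative_linear, THEN linear_neg] algebra_simps)
  qed
  \<comment> \<open>Comparing with \<open>c\<^sup>2\<close> instead of \<open>c\<close> saves the factor 2 that the plain mean value theorem would lose.\<close>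
  have "\<exists>c>0. c < 1 \<and> (?\<theta> 1 - ?\<theta> 0) * (2 * c) = (1\<^sup>2 - 0\<^sup>2) * (G' (x + c *\<^sub>R u) u - G' (x - c *\<^sub>R u) u)"
    by (rule GMVT') (auto intro!: d\<theta> DERIV_isCont[OF d\<theta>] derivative_eq_intros)
  then obtain c where c: "0 < c" "c < 1"
    "(?\<theta> 1 - ?\<theta> 0) * (2 * c) = G' (x + c *\<^sub>R u) u - G' (x - c *\<^sub>R u) u"
    by auto
  have "\<bar>?\<theta> 1 - ?\<theta> 0\<bar> * (2 * c) = \<bar>G' (x + c *\<^sub>R u) u - G' (x - c *\<^sub>R u) u\<bar>"
    using c by (simp flip: c(3) add: abs_mult)
  also have "\<dots> \<le> K * norm ((x + c *\<^sub>R u) - (x - c *\<^sub>R u)) * norm u"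
    by (rule lip) (use ball c in auto)
  also have "(x + c *\<^sub>R u) - (x - c *\<^sub>R u) = (2 * c) *\<^sub>R u"
    by (simp add: scaleR_2 flip: scaleR_scaleR)
  also have "K * norm ((2 * c) *\<^sub>R u) * norm u = K * (norm u)\<^sup>2 * (2 * c)"
    using c by (simp add: power2_eq_square)
  finally show ?thesis
    using c by (simp add: diff_diff_eq)
qed

section \<open>Derivatives inside a closed ball\<close>

lemma fderiv_has_derivative:
  assumes "f differentiable_on X" "x \<in> interior X"
  shows "(f has_derivative blinfun_apply (fderiv X f x)) (at x)"
proof -
  have "f differentiable (at x within X)"
    using assms interior_subset by (auto simp: differentiable_on_def)
  then have "(f has_derivative frechet_derivative f (at x)) (at x)"
    using assms by (simp add: at_within_interior[of x X] frechet_derivative_works)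
  then show ?thesis
    by (simp add: fderiv_def at_within_interior[OF assms(2)]
        bounded_linear_Blinfun_apply[OF has_derivative_bounded_linear])
qed

text \<open>Evaluating at fixed vectors is bounded linear, so it commutes with differentiation. This
  turns derivatives of operator-valued maps into derivatives of scalar functions.\<close>

lemma thrice_differentiable_on_has_derivative:
  assumes "thrice_differentiable_on f X" "x \<in> interior X"
  shows "(f has_derivative fderiv X f x) (at x)"
    and "((\<lambda>y. fderiv X f y v) has_derivative (\<lambda>u. fderiv2 X f x u v)) (at x)"
    and "((\<lambda>y. fderiv2 X f y v w) has_derivative (\<lambda>u. fderiv3 X f x u v w)) (at x)"
proof -
  show "(f has_derivative fderiv X f x) (at x)"
    using assms by (intro fderiv_has_derivative) (auto simp: thrice_differentiable_on_def)
  have "(fderiv X f has_derivative fderiv2 X f x) (at x)"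
    unfolding fderiv2_def
    using assms by (intro fderiv_has_derivative) (auto simp: thrice_differentiable_on_def)
  then show "((\<lambda>y. fderiv X f y v) has_derivative (\<lambda>u. fderiv2 X f x u v)) (at x)"
    by (rule bounded_linear.has_derivative[OF blinfun.bounded_linear_left])
  have "(fderiv2 X f has_derivative fderiv3 X f x) (at x)"
    unfolding fderiv3_def
    using assms by (intro fderiv_has_derivative) (auto simp: thrice_differentiable_on_def)
  then show "((\<lambda>y. fderiv2 X f y v w) has_derivative (\<lambda>u. fderiv3 X f x u v w)) (at x)"
    by (intro bounded_linear.has_derivative[OF blinfun.bounded_linear_left]
        bounded_linear.has_derivative[OF blinfun.bounded_linear_left, of "fderiv2 X f"])
qed

text \<open>The row index of \<open>hessian\<close> is the first argument of \<open>fderiv2\<close>,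
  so only \<open>t\<close> has to be expanded in the basis.\<close>

lemma fderiv2_eq_hessian:
  "fderiv2 X f x (axis i 1) t = (hessian X f x *v t) $ i"
proof -
  have "fderiv2 X f x (axis i 1) t = fderiv2 X f x (axis i 1) (\<Sum>j\<in>UNIV. t $ j *\<^sub>R axis j 1)"
    using basis_expansion[of t] by (simp add: scalar_mult_eq_scaleR)
  then show ?thesis
    by (simp add: blinfun.sum_right blinfun.scaleR_right hessian_def matrix_vector_mult_def mult.commute)
qed

section \<open>Error bounds for second differences\<close>

text \<open>The Lipschitz hypothesis concerns the fixed pair \<open>s\<close>, \<open>t\<close> and
  the center \<open>x\<close> only, so that \<open>K\<close> can absorb the lengths of
  \<open>s\<close> and \<open>t\<close>.\<close>

lemma second_difference_error:
  fixes f :: "'a::euclidean_space \<Rightarrow> real"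
  assumes f: "thrice_differentiable_on f (cball x \<Delta>)"
    and lip: "\<And>y. y \<in> ball x \<Delta> \<Longrightarrow>
      \<bar>fderiv2 (cball x \<Delta>) f y s t - fderiv2 (cball x \<Delta>) f x s t\<bar> \<le> K * norm (y - x)"
    and "0 \<le> K" and "norm s + \<rho> \<le> \<Delta>" "norm t \<le> \<rho>" "0 < \<rho>"
  shows "\<bar>f (x + s + t) - f (x + s) - f (x + t) + f x - fderiv2 (cball x \<Delta>) f x s t\<bar>
    \<le> K * (norm s + norm t)"
proof -
  let ?F1 = "fderiv (cball x \<Delta>) f" and ?F2 = "fderiv2 (cball x \<Delta>) f"
  have fcont: "continuous_on (cball x \<Delta>) f"
    using f by (auto simp: thrice_differentiable_on_def intro: differentiable_imp_continuous_on)
  have cont: "continuous_on (cball 0 \<Delta>) (\<lambda>y. f (x + y))"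
    by (intro continuous_on_compose2[OF fcont] continuous_intros) (auto simp: dist_norm)
  have shift: "((\<lambda>y. x + y) has_derivative (\<lambda>u. u)) (at y)" for y
    by (auto intro!: derivative_eq_intros)
  have inner: "x + y \<in> interior (cball x \<Delta>)" if "norm y < \<Delta>" for y
    using that by (simp add: interior_cball dist_norm)
  obtain u where u: "norm u \<le> norm s + norm t" "norm u < \<Delta>"
    "f (x + (s + t)) - f (x + s) - f (x + t) + f (x + 0) = ?F2 (x + u) s t"
  proof (rule second_difference_eq[OF cont _ _ assms(4-6)])
    show "((\<lambda>y. f (x + y)) has_derivative ?F1 (x + y)) (at y)" if "norm y < \<Delta>" for y
      by (rule has_derivative_compose[OF shift
            thrice_differentiable_on_has_derivative(1)[OF f inner[OF that]]])
    show "((\<lambda>z. ?F1 (x + z) v) has_derivative (\<lambda>u. ?F2 (x + y) u v)) (at y)"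
      if "norm y < \<Delta>" for y v
      by (rule has_derivative_compose[OF shift
            thrice_differentiable_on_has_derivative(2)[OF f inner[OF that]]])
  qed
  have "\<bar>?F2 (x + u) s t - ?F2 x s t\<bar> \<le> K * norm u"
    using lip[of "x + u"] u by (simp add: dist_norm)
  also have "\<dots> \<le> K * (norm s + norm t)"
    using u \<open>0 \<le> K\<close> by (intro mult_left_mono)
  finally show ?thesis
    using u(3) by (simp add: add.assoc)
qed

text \<open>The two brackets add up to the second difference at 0 of the even function
  \<open>f (x + y) + f (x - y)\<close>. Its second derivative at \<open>u\<close> is a symmetric
  sum, handled by \<open>symmetric_difference_bound\<close> with \<open>G\<close> the second
  derivative of \<open>f\<close> along \<open>s\<close> and \<open>t\<close>.\<close>

lemma centered_second_difference_error:
  fixes f :: "'a::euclidean_space \<Rightarrow> real"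
  assumes f: "thrice_differentiable_on f (cball x \<Delta>)"
    and lip: "L-lipschitz_on (cball x \<Delta>) (fderiv3 (cball x \<Delta>) f)"
    and "norm s + \<rho> \<le> \<Delta>" "norm t \<le> \<rho>" "0 < \<rho>"
  shows "\<bar>(f (x + s + t) - f (x + s) - f (x + t) + f x) + (f (x - s - t) - f (x - s) - f (x - t) + f x)
      - 2 * fderiv2 (cball x \<Delta>) f x s t\<bar> \<le> L * norm s * norm t * (norm s + norm t)\<^sup>2"
proof -
  let ?F1 = "fderiv (cball x \<Delta>) f" and ?F2 = "fderiv2 (cball x \<Delta>) f"
    and ?F3 = "fderiv3 (cball x \<Delta>) f"
  have fcont: "continuous_on (cball x \<Delta>) f"
    using f by (auto simp: thrice_differentiable_on_def intro: differentiable_imp_continuous_on)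
  have cont: "continuous_on (cball 0 \<Delta>) (\<lambda>y. f (x + y) + f (x - y))"
    by (intro continuous_on_add continuous_on_compose2[OF fcont] continuous_intros)
      (auto simp: dist_norm)
  have plus: "((\<lambda>y. x + y) has_derivative (\<lambda>u. u)) (at y)"
    and minus: "((\<lambda>y. x - y) has_derivative (\<lambda>u. - u)) (at y)" for y
    by (auto intro!: derivative_eq_intros)
  have inner: "x + y \<in> interior (cball x \<Delta>)" "x - y \<in> interior (cball x \<Delta>)" if "norm y < \<Delta>" for y
    using that by (simp_all add: interior_cball dist_norm)
  obtain u where u: "norm u \<le> norm s + norm t" "norm u < \<Delta>"
    "(f (x + (s + t)) + f (x - (s + t))) - (f (x + s) + f (x - s)) - (f (x + t) + f (x - t))
      + (f (x + 0) + f (x - 0)) = ?F2 (x + u) s t + ?F2 (x - u) s t"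
  proof (rule second_difference_eq[OF cont _ _ assms(3-5)])
    fix y :: 'a assume y: "norm y < \<Delta>"
    note D = thrice_differentiable_on_has_derivative[OF f]
    show "((\<lambda>y. f (x + y) + f (x - y)) has_derivative (\<lambda>v. ?F1 (x + y) v - ?F1 (x - y) v)) (at y)"
      using has_derivative_add[OF has_derivative_compose[OF plus D(1)[OF inner(1)[OF y]]]
          has_derivative_compose[OF minus D(1)[OF inner(2)[OF y]]]]
      by (simp add: blinfun.minus_right)
    show "((\<lambda>z. ?F1 (x + z) v - ?F1 (x - z) v) has_derivative
        (\<lambda>u. ?F2 (x + y) u v + ?F2 (x - y) u v)) (at y)" for v
      using has_derivative_diff[OF has_derivative_compose[OF plus D(2)[OF inner(1)[OF y], of v]]
          has_derivative_compose[OF minus D(2)[OF inner(2)[OF y], of v]]]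
      by (simp add: blinfun.minus_right blinfun.minus_left)
  qed
  have "\<bar>?F2 (x + u) s t + ?F2 (x - u) s t - 2 * ?F2 x s t\<bar> \<le> (L * norm s * norm t) * (norm u)\<^sup>2"
  proof (rule symmetric_difference_bound[OF _ _ u(2)])
    show "((\<lambda>y. ?F2 y s t) has_derivative (\<lambda>v. ?F3 y v s t)) (at y)" if "y \<in> ball x \<Delta>" for y
      by (rule thrice_differentiable_on_has_derivative(3)[OF f]) (use that in \<open>simp add: interior_cball\<close>)
    fix y z v assume yz: "y \<in> ball x \<Delta>" "z \<in> ball x \<Delta>"
    have "\<bar>?F3 y v s t - ?F3 z v s t\<bar> = norm ((?F3 y - ?F3 z) v s t)"
      by (simp add: blinfun.diff_left)
    also have "\<dots> \<le> norm ((?F3 y - ?F3 z) v s) * norm t"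
      by (rule norm_blinfun)
    also have "\<dots> \<le> norm ((?F3 y - ?F3 z) v) * norm s * norm t"
      by (intro mult_right_mono norm_blinfun norm_ge_zero)
    also have "\<dots> \<le> norm (?F3 y - ?F3 z) * norm v * norm s * norm t"
      by (intro mult_right_mono norm_blinfun norm_ge_zero)
    also have "\<dots> \<le> L * norm (y - z) * norm v * norm s * norm t"
      using lipschitz_onD[OF lip, of y z] yz by (intro mult_right_mono) (auto simp: dist_norm)
    finally show "\<bar>?F3 y v s t - ?F3 z v s t\<bar> \<le> L * norm s * norm t * norm (y - z) * norm v"
      by (simp add: algebra_simps)
  qed
  also have "\<dots> \<le> (L * norm s * norm t) * (norm s + norm t)\<^sup>2"
    using u(1) lipschitz_on_nonneg[OF lip] by (intro mult_left_mono power_mono) auto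
  also have "?F2 (x + u) s t + ?F2 (x - u) s t =
      (f (x + s + t) - f (x + s) - f (x + t) + f x) + (f (x - s - t) - f (x - s) - f (x - t) + f x)"
    using u(3) by (simp add: add.assoc diff_diff_eq)
  finally show ?thesis .
qed

lemma spec_norm_axis_row_diff:
  fixes v w :: "real^'k"
  assumes "\<And>j. \<bar>v $ j - w $ j\<bar> \<le> c"
  shows "spec_norm (axis_row i (v v* P) - axis_row i (w v* P)) \<le> sqrt (real CARD('k)) * c * spec_norm P"
proof -
  have "spec_norm (axis_row i (v v* P) - axis_row i (w v* P)) \<le> norm (v - w) * spec_norm P"
    using spec_norm_axis_row[of i "v - w" P]
    by (simp add: axis_row_diff vector_matrix_mult_diff_distrib)
  also have "\<dots> \<le> sqrt (real CARD('k)) * c * spec_norm P"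
    using assms by (intro mult_right_mono norm_vec_le_sqrt_card spec_norm_nonneg) auto
  finally show ?thesis .
qed


section \<open>The error bounds for both simplex Hessians\<close>

theorem corollary19:
  fixes f :: "real^'n \<Rightarrow> real" and D :: "(real^'n) set" and x0 :: "real^'n"
    and \<Delta> L2 L3 h :: real and i :: 'n
    and S :: "real^1^'n" and T :: "real^'k^'n"
  assumes "x0 \<in> D" and "\<Delta> > 0" and "cball x0 \<Delta> \<subseteq> D"
    and "C4_on f (ball x0 \<Delta>)"
    and "thrice_differentiable_on f (cball x0 \<Delta>)"
    and "L2 \<ge> 0"
    and "\<And>x y. x \<in> cball x0 \<Delta> \<Longrightarrow> y \<in> cball x0 \<Delta> \<Longrightarrow>
           spec_norm (hessian (cball x0 \<Delta>) f x - hessian (cball x0 \<Delta>) f y) \<le> L2 * norm (x - y)"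
    and "L3 \<ge> 0"
    and "L3-lipschitz_on (cball x0 \<Delta>) (fderiv3 (cball x0 \<Delta>) f)"
    and "h \<noteq> 0" and "S = columnvector (h *\<^sub>R axis i 1)"
    and "rank S \<noteq> 0" and "rank T \<noteq> 0"
    and "simplex_hessian_defined D x0 S T"
    and "centered_simplex_hessian_defined D x0 S T"
    and "ball (x0 + h *\<^sub>R axis i 1) (radius T) \<subseteq> ball x0 \<Delta>"
  shows "(spec_norm (proj_op S T (simplex_hessian f x0 S T) - proj_op S T (hessian UNIV f x0))
            = spec_norm (simplex_hessian f x0 S T - proj_op S T (Diag (axis i 1) ** hessian UNIV f x0))
          \<and> spec_norm (simplex_hessian f x0 S T - proj_op S T (Diag (axis i 1) ** hessian UNIV f x0))
            \<le> 4 * sqrt (real CARD('k)) * L2 * (radius_u S T / radius_l S T)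
                * spec_norm (pinv (normalized T)) * radius_u S T)
       \<and> (spec_norm (proj_op S T (centered_simplex_hessian f x0 S T) - proj_op S T (hessian UNIV f x0))
            = spec_norm (centered_simplex_hessian f x0 S T - proj_op S T (Diag (axis i 1) ** hessian UNIV f x0))
          \<and> spec_norm (centered_simplex_hessian f x0 S T - proj_op S T (Diag (axis i 1) ** hessian UNIV f x0))
            \<le> 2 * sqrt (real CARD('k)) * L3 * (radius_u S T / radius_l S T)
                * spec_norm (pinv (normalized T)) * (radius_u S T)\<^sup>2)"
proof -
  let ?s = "h *\<^sub>R axis i 1 :: real^'n" and ?R = "radius T"
  let ?U = "radius_u S T" and ?l = "radius_l S T"
  let ?H = "hessian UNIV f x0" and ?X = "cball x0 \<Delta>" and ?P = "pinv T"
  note h = \<open>h \<noteq> 0\<close> and S = \<open>S = columnvector ?s\<close>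
  have R: "0 < ?R"
    using radius_pos assms(13) by blast
  have radS: "radius S = \<bar>h\<bar>"
    by (simp add: S radius_columnvector)
  have U: "\<bar>h\<bar> \<le> ?U" "?R \<le> ?U" and l: "0 < ?l" "?l \<le> ?U"
    using h R by (auto simp: radius_u_def radius_l_def radS)
  \<comment> \<open>Since the inner ball is nonempty, the inclusion of open balls is this
    inequality. Equality is possible, and then sample points can reach the sphere.\<close>
  have hR: "norm ?s + ?R \<le> \<Delta>"
    using assms(16) R by (simp add: ball_subset_ball_iff dist_norm)
  have x0: "x0 \<in> interior ?X"
    using \<open>\<Delta> > 0\<close> by (simp add: interior_cball)
  have T: "norm (column j T) \<le> ?R" for j
    by (rule norm_column_le_radius)
  have sum: "norm ?s + norm (column j T) \<le> 2 * ?U" for j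
    using U T[of j] by simp
  \<comment> \<open>The vector that the scaled second differences should approximate: entry
    \<open>j\<close> is the second derivative at \<open>x0\<close> along \<open>e^i\<close> and
    column \<open>j\<close> of \<open>T\<close>.\<close>
  define w where "w = row i ?H v* T"
  have w: "w $ j = (?H *v column j T) $ i" for j
    by (simp add: w_def vector_matrix_mult_def matrix_vector_mult_def row_def column_def)
  have F2: "fderiv2 ?X f y ?s t = h * (hessian ?X f y *v t) $ i" for y t
    by (simp add: blinfun.scaleR_right blinfun.scaleR_left fderiv2_eq_hessian)
  have F2_x0: "fderiv2 ?X f x0 ?s (column j T) = h * w $ j" for j
    by (simp add: F2 w hessian_interior[OF x0])
  \<comment> \<open>The factor \<open>?R\<close> is absorbed by normalizing \<open>T\<close>, and
    the ratio \<open>?U / ?l\<close>, which is at least 1, is inserted. Powers of \<open>?U\<close>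
    are carried inside \<open>L\<close> in both applications.\<close>
  have final: "M * (sqrt (real CARD('k)) * (L * ?R) * spec_norm ?P)
      \<le> M * sqrt (real CARD('k)) * L * (?U / ?l) * spec_norm (pinv (normalized T))"
    if "0 \<le> L" "0 \<le> M" for L M
  proof -
    let ?Q = "M * sqrt (real CARD('k)) * L * (?R * spec_norm ?P)"
    have "0 \<le> ?Q"
      using that R by (simp add: spec_norm_nonneg)
    moreover have "1 \<le> ?U / ?l"
      using l by simp
    ultimately have "?Q * 1 \<le> ?Q * (?U / ?l)"
      by (rule mult_left_mono[rotated])
    then show ?thesis
      by (simp add: spec_norm_pinv_normalized[OF R] mult_ac)
  qed

  let ?d = "\<lambda>j. f (x0 + ?s + column j T) - f (x0 + ?s) - f (x0 + column j T) + f x0"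
  let ?d' = "\<lambda>j. f (x0 - ?s - column j T) - f (x0 - ?s) - f (x0 - column j T) + f x0"
  define v where "v = (\<chi> j. ?d j / h)"
  define c where "c = (\<chi> j. (?d j + ?d' j) / (2 * h))"
  have sh: "simplex_hessian f x0 S T = axis_row i (v v* ?P)"
    unfolding S v_def by (rule simplex_hessian_axis[OF h])
  have ch: "centered_simplex_hessian f x0 S T = axis_row i (c v* ?P)"
    unfolding S c_def by (rule centered_simplex_hessian_axis[OF h])
  have proj: "proj_op S T ?H = axis_row i (w v* ?P)"
    "proj_op S T (Diag (axis i 1) ** ?H) = axis_row i (w v* ?P)"
    unfolding S w_def proj_op_axis_Diag[OF h] by (rule proj_op_axis[OF h])+
  have fixed: "proj_op S T (axis_row i (u v* ?P)) = axis_row i (u v* ?P)" for u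
    unfolding S by (rule proj_op_axis_row[OF h])

  have v_bound: "\<bar>v $ j - w $ j\<bar> \<le> 2 * L2 * ?U * ?R" for j
  proof -
    let ?t = "column j T"
    \<comment> \<open>The factor \<open>\<bar>h\<bar>\<close> in the constant cancels against the
      division by \<open>h\<close> in \<open>v\<close>; the factor 2 in \<open>v_bound\<close> comes
      from the fact \<open>sum\<close>.\<close>
    have "\<bar>?d j - fderiv2 ?X f x0 ?s ?t\<bar> \<le> (L2 * norm ?t * \<bar>h\<bar>) * (norm ?s + norm ?t)"
    proof (rule second_difference_error[OF assms(5) _ _ hR T R])
      fix y assume y: "y \<in> ball x0 \<Delta>"
      have "fderiv2 ?X f y ?s ?t - fderiv2 ?X f x0 ?s ?t
          = h * ((hessian ?X f y - hessian ?X f x0) *v ?t) $ i"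
        by (simp only: F2 matrix_vector_mult_diff_rdistrib vector_minus_component right_diff_distrib)
      also have "\<bar>\<dots>\<bar> \<le> \<bar>h\<bar> * norm ((hessian ?X f y - hessian ?X f x0) *v ?t)"
        by (simp only: abs_mult) (intro mult_left_mono component_le_norm_cart abs_ge_zero)
      also have "\<dots> \<le> \<bar>h\<bar> * (spec_norm (hessian ?X f y - hessian ?X f x0) * norm ?t)"
        by (intro mult_left_mono norm_mult_le_spec_norm abs_ge_zero)
      also have "\<dots> \<le> \<bar>h\<bar> * ((L2 * norm (y - x0)) * norm ?t)"
        using assms(7)[of y x0] y \<open>\<Delta> > 0\<close> by (intro mult_left_mono mult_right_mono) auto
      finally show "\<bar>fderiv2 ?X f y ?s ?t - fderiv2 ?X f x0 ?s ?t\<bar> \<le> L2 * norm ?t * \<bar>h\<bar> * norm (y - x0)"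
        by (simp only: mult_ac)
    qed (use \<open>L2 \<ge> 0\<close> in simp)
    also have "\<dots> \<le> (L2 * ?R * \<bar>h\<bar>) * (2 * ?U)"
      using \<open>L2 \<ge> 0\<close> R by (intro mult_mono mult_left_mono mult_right_mono T sum) auto
    finally have "\<bar>?d j - h * w $ j\<bar> \<le> (2 * L2 * ?U * ?R) * \<bar>h\<bar>"
      by (simp add: F2_x0 mult_ac)
    moreover have "\<bar>v $ j - w $ j\<bar> = \<bar>?d j - h * w $ j\<bar> / \<bar>h\<bar>"
      using h by (simp add: v_def abs_divide[symmetric] diff_divide_distrib)
    ultimately show ?thesis
      using h by (simp add: pos_divide_le_eq)
  qed

  have c_bound: "\<bar>c $ j - w $ j\<bar> \<le> 2 * L3 * ?U\<^sup>2 * ?R" for j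
  proof -
    let ?t = "column j T"
    have "\<bar>?d j + ?d' j - 2 * fderiv2 ?X f x0 ?s ?t\<bar> \<le> L3 * norm ?s * norm ?t * (norm ?s + norm ?t)\<^sup>2"
      by (rule centered_second_difference_error[OF assms(5,9) hR T R])
    also have "\<dots> \<le> L3 * norm ?s * ?R * (2 * ?U)\<^sup>2"
      using \<open>L3 \<ge> 0\<close> R by (intro mult_mono mult_left_mono power_mono T sum) auto
    \<comment> \<open>Squaring \<open>2 * ?U\<close> gives a factor 4; half of it goes with
      \<open>h\<close> into the divisor \<open>2 * h\<close> of \<open>c\<close>, which leaves the
      constant 2.\<close>
    finally have "\<bar>?d j + ?d' j - 2 * (h * w $ j)\<bar> \<le> (2 * L3 * ?U\<^sup>2 * ?R) * \<bar>2 * h\<bar>"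
      by (simp add: F2_x0 power_mult_distrib abs_mult mult_ac)
    moreover have "\<bar>c $ j - w $ j\<bar> = \<bar>?d j + ?d' j - 2 * (h * w $ j)\<bar> / \<bar>2 * h\<bar>"
    proof -
      have "(a - 2 * (h * b)) / (2 * h) = a / (2 * h) - b" for a b
        using h by (simp add: diff_divide_distrib)
      then show ?thesis
        by (simp only: c_def vec_lambda_beta abs_divide[symmetric])
    qed
    ultimately show ?thesis
      using h by (simp add: pos_divide_le_eq)
  qed

  have "spec_norm (axis_row i (v v* ?P) - axis_row i (w v* ?P))
      \<le> 4 * sqrt (real CARD('k)) * L2 * (?U / ?l) * spec_norm (pinv (normalized T)) * ?U"
  proof -
    have nn: "0 \<le> sqrt (real CARD('k)) * (L2 * ?U * ?R) * spec_norm ?P"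
      using R U \<open>L2 \<ge> 0\<close> by (simp add: spec_norm_nonneg)
    have "spec_norm (axis_row i (v v* ?P) - axis_row i (w v* ?P))
        \<le> sqrt (real CARD('k)) * (2 * L2 * ?U * ?R) * spec_norm ?P"
      by (rule spec_norm_axis_row_diff) (rule v_bound)
    \<comment> \<open>The estimate so far has the constant 2; here it is relaxed to the stated
      4.\<close>
    also have "\<dots> \<le> 4 * (sqrt (real CARD('k)) * ((L2 * ?U) * ?R) * spec_norm ?P)"
      using nn by (simp add: mult_ac)
    also have "\<dots> \<le> 4 * sqrt (real CARD('k)) * (L2 * ?U) * (?U / ?l) * spec_norm (pinv (normalized T))"
      using R U \<open>L2 \<ge> 0\<close> by (intro final) auto
    finally show ?thesis
      by (simp only: mult_ac)
  qed
  moreover have "spec_norm (axis_row i (c v* ?P) - axis_row i (w v* ?P))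
      \<le> 2 * sqrt (real CARD('k)) * L3 * (?U / ?l) * spec_norm (pinv (normalized T)) * ?U\<^sup>2"
  proof -
    have "spec_norm (axis_row i (c v* ?P) - axis_row i (w v* ?P))
        \<le> sqrt (real CARD('k)) * (2 * L3 * ?U\<^sup>2 * ?R) * spec_norm ?P"
      by (rule spec_norm_axis_row_diff) (rule c_bound)
    also have "\<dots> = 2 * (sqrt (real CARD('k)) * ((L3 * ?U\<^sup>2) * ?R) * spec_norm ?P)"
      by (simp only: mult_ac)
    also have "\<dots> \<le> 2 * sqrt (real CARD('k)) * (L3 * ?U\<^sup>2) * (?U / ?l) * spec_norm (pinv (normalized T))"
      using \<open>L3 \<ge> 0\<close> by (intro final) auto
    finally show ?thesis
      by (simp only: mult_ac)
  qed
  ultimately show ?thesis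
    by (simp only: sh ch proj fixed simp_thms)
qed

end
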